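(* Let $W=\{1,\dots,n\}$ be a finite non-empty set of voters and let $\mathfrak{G}\subseteq\mathcal{P}(W)$ be a set of winning coalitions such that $W\in\mathfrak{G}$, $\emptyset\notin\mathfrak{G}$, and $\mathfrak{G}$ is monotone (if $A\in\mathfrak{G}$ and $A\subseteq B\subseteq W$ then $B\in\mathfrak{G}$). Let $\mathfrak{M}(\mathfrak{G})=\{V_1,\dots,V_m\}$ be the set of minimal winning coalitions, with $m=\#\mathfrak{M}(\mathfrak{G})$. For a voter $w\in W$ define the Banzhaf score $BS_w:=\#\{C\in\mathfrak{G}\mid w\in C,\ C\setminus\{w\}\notin\mathfrak{G}\}$. Then for each voter $w$, $$BS_w=\sum_{r=1}^m(-1)^{r-1}\sum_{1\leq i_1<\dots<i_r\leq m} t_{i_1,\dots,i_r}(w),$$ where $$t_{i_1,\dots,i_r}(w):=\begin{cases}2^{\,n-\#\bigcup_{j=1}^rV_{i_j}}, & \text{if } w\in\bigcup_{j=1}^rV_{i_j},\\ 0, & \text{if } w\notin\bigcup_{j=1}^rV_{i_j}.\end{cases}$$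
   Context: A coalition is a subset of $W$; $\mathcal{P}(W)$ is the power set of $W$ and $\#A$ denotes cardinality. A minimal winning coalition is a $V\in\mathfrak{G}$ such that $V\setminus\{i\}\notin\mathfrak{G}$ for every $i\in V$. *)

theory Defs
  imports Main
begin

definition simple_game :: "'a set \<Rightarrow> 'a set set \<Rightarrow> bool" where
  "simple_game W G \<longleftrightarrow>
     finite W \<and> W \<noteq> {} \<and> G \<subseteq> Pow W \<and> W \<in> G \<and> {} \<notin> G \<and>
     (\<forall>A B. A \<in> G \<longrightarrow> A \<subseteq> B \<longrightarrow> B \<subseteq> W \<longrightarrow> B \<in> G)"

definition minimal_winning :: "'a set set \<Rightarrow> 'a set set" where
  "minimal_winning G = {V \<in> G. \<forall>i \<in> V. V - {i} \<notin> G}"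

definition banzhaf_score :: "'a set set \<Rightarrow> 'a \<Rightarrow> nat" where
  "banzhaf_score G w = card {C \<in> G. w \<in> C \<and> C - {w} \<notin> G}"

(* An index tuple 1 <= i_1 < ... < i_r <= m is encoded as the strictly increasing list
   [i_1, ..., i_r]. *)
definition increasing_tuples :: "nat \<Rightarrow> nat \<Rightarrow> nat list set" where
  "increasing_tuples m r = {ks. length ks = r \<and> sorted_wrt (<) ks \<and> set ks \<subseteq> {1..m}}"

(* The exponent is a subtraction on nat; it does not truncate when every V k is a subset of
   the finite set W. *)
definition tuple_term :: "'a set \<Rightarrow> (nat \<Rightarrow> 'a set) \<Rightarrow> nat list \<Rightarrow> 'a \<Rightarrow> int" where
  "tuple_term W V ks w =
     (if w \<in> (\<Union>k\<in>set ks. V k) then 2 ^ (card W - card (\<Union>k\<in>set ks. V k)) else 0)"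

end

theory Submission
  imports Defs "HOL.Binomial"
begin

text \<open>
  In a finite family \<open>G\<close> closed under adding \<open>w\<close>, the map \<open>C \<mapsto> C \<union> {w}\<close> pairs the members avoiding
  \<open>w\<close> with the members that contain \<open>w\<close> but are not counted by the Banzhaf score. Hence the score
  is the sum over \<open>G\<close> of the sign \<open>+1\<close> (if \<open>w \<in> C\<close>) or \<open>-1\<close> (if \<open>w \<notin> C\<close>), which is additive in
  \<open>G\<close>. The winning coalitions are the union of the up-sets generated by the minimal ones, so
  inclusion-exclusion applies; an intersection of such up-sets is the up-set generated by the
  union \<open>U\<close> of the generators, whose score is \<open>2 ^ (n - #U)\<close> or \<open>0\<close>.
\<close>

lemma banzhaf_score_eq_sum_sign:
  assumes fin: "finite G" and closed: "\<And>C. C \<in> G \<Longrightarrow> insert w C \<in> G"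
  shows "int (banzhaf_score G w) = (\<Sum>C\<in>G. if w \<in> C then 1 else -1)"
proof -
  let ?in = "{C \<in> G. w \<in> C}" and ?out = "{C \<in> G. w \<notin> C}"
  have "?in = {C \<in> G. w \<in> C \<and> C - {w} \<notin> G} \<union> insert w ` ?out"
  proof (intro equalityI subsetI)
    fix C assume C: "C \<in> ?in"
    show "C \<in> {C \<in> G. w \<in> C \<and> C - {w} \<notin> G} \<union> insert w ` ?out"
    proof (cases "C - {w} \<in> G")
      case True
      then have "insert w (C - {w}) \<in> insert w ` ?out" by blast
      then show ?thesis using C by (simp add: insert_absorb)
    qed (use C in simp)
  qed (use closed in auto)
  moreover have "{C \<in> G. w \<in> C \<and> C - {w} \<notin> G} \<inter> insert w ` ?out = {}"
    by auto
  moreover have "inj_on (insert w) ?out"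
    by (auto simp: inj_on_def)
  ultimately have card_in: "card ?in = banzhaf_score G w + card ?out"
    using fin by (simp add: card_Un_disjoint card_image banzhaf_score_def)
  have "(\<Sum>C\<in>G. if w \<in> C then 1 else -1) = int (card ?in) - int (card ?out)"
    using fin by (simp add: sum.If_cases Int_def)
  with card_in show ?thesis by simp
qed

lemma card_subset_interval:
  assumes "finite W" "U \<subseteq> W"
  shows "card {C. U \<subseteq> C \<and> C \<subseteq> W} = 2 ^ (card W - card U)"
proof -
  have "bij_betw (\<lambda>D. D \<union> U) (Pow (W - U)) {C. U \<subseteq> C \<and> C \<subseteq> W}"
    by (rule bij_betw_byWitness[where f' = "\<lambda>C. C - U"]) (use assms in auto)
  then show ?thesis
    using assms finite_subset[OF assms(2,1)]
    by (simp add: bij_betw_same_card[symmetric] card_Pow card_Diff_subset)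
qed

text \<open>If \<open>w\<close> is in \<open>U\<close>, deleting \<open>w\<close> always leaves the
  up-set of \<open>U\<close>, so every member counts. Otherwise \<open>C - {w}\<close> still
  contains \<open>U\<close>, so none does.\<close>

lemma banzhaf_score_subset_interval:
  assumes "finite W" "U \<subseteq> W"
  shows "banzhaf_score {C. U \<subseteq> C \<and> C \<subseteq> W} w = (if w \<in> U then 2 ^ (card W - card U) else 0)"
proof (cases "w \<in> U")
  case True
  then have "{C \<in> {C. U \<subseteq> C \<and> C \<subseteq> W}. w \<in> C \<and> C - {w} \<notin> {C. U \<subseteq> C \<and> C \<subseteq> W}}
      = {C. U \<subseteq> C \<and> C \<subseteq> W}"
    by auto
  with True show ?thesis
    by (simp only: banzhaf_score_def card_subset_interval[OF assms] if_True)
next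
  case False
  then have "{C \<in> {C. U \<subseteq> C \<and> C \<subseteq> W}. w \<in> C \<and> C - {w} \<notin> {C. U \<subseteq> C \<and> C \<subseteq> W}} = {}"
    by auto
  with False show ?thesis
    by (simp only: banzhaf_score_def card.empty if_False)
qed

text \<open>Finiteness gives an inclusion-minimal member of \<open>G\<close> inside
  \<open>C\<close>, and deleting any one voter from it must then leave \<open>G\<close>.\<close>

lemma ex_minimal_winning_subset:
  assumes "finite G" "C \<in> G" "\<And>A. A \<in> G \<Longrightarrow> finite A"
  obtains M where "M \<in> minimal_winning G" "M \<subseteq> C"
proof -
  obtain M where M: "M \<in> G" "M \<subseteq> C" "\<forall>B\<in>G. B \<subseteq> M \<longrightarrow> M = B"
    using finite_has_minimal2[OF assms(1,2)] by metis
  then have "M \<in> minimal_winning G"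
    unfolding minimal_winning_def by blast
  with M(2) show ?thesis by (rule that[rotated])
qed

text \<open>Descent to a minimal winning coalition gives one inclusion, monotonicity the
  other.\<close>

lemma simple_game_eq_Union_intervals:
  assumes "simple_game W G"
  shows "G = (\<Union>M\<in>minimal_winning G. {C. M \<subseteq> C \<and> C \<subseteq> W})"
proof (intro equalityI subsetI)
  have fin: "finite W" and sub: "G \<subseteq> Pow W"
    using assms by (auto simp: simple_game_def)
  fix C assume "C \<in> G"
  moreover have "finite G" "\<And>A. A \<in> G \<Longrightarrow> finite A"
    using fin sub by (auto intro: finite_subset)
  ultimately obtain M where "M \<in> minimal_winning G" "M \<subseteq> C"
    using ex_minimal_winning_subset by metis
  then show "C \<in> (\<Union>M\<in>minimal_winning G. {C. M \<subseteq> C \<and> C \<subseteq> W})"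
    using \<open>C \<in> G\<close> sub by blast
next
  fix C assume "C \<in> (\<Union>M\<in>minimal_winning G. {C. M \<subseteq> C \<and> C \<subseteq> W})"
  then show "C \<in> G"
    using assms unfolding simple_game_def minimal_winning_def by blast
qed

text \<open>A strictly increasing list is recovered by sorting its set of entries, so sums over
  index tuples can be read as sums over index sets.\<close>

lemma bij_betw_set_increasing_tuples:
  "bij_betw set (increasing_tuples m r) {I. I \<subseteq> {1..m} \<and> card I = r}"
proof (rule bij_betw_byWitness[where f' = sorted_list_of_set])
  show "\<forall>ks\<in>increasing_tuples m r. sorted_list_of_set (set ks) = ks"
    by (auto simp: increasing_tuples_def intro: strict_sorted_equal)
  show "\<forall>I\<in>{I. I \<subseteq> {1..m} \<and> card I = r}. set (sorted_list_of_set I) = I"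
    by (simp add: finite_subset[of _ "{1..m}"])
  show "set ` increasing_tuples m r \<subseteq> {I. I \<subseteq> {1..m} \<and> card I = r}"
    by (auto simp: increasing_tuples_def strict_sorted_iff distinct_card)
  show "sorted_list_of_set ` {I. I \<subseteq> {1..m} \<and> card I = r} \<subseteq> increasing_tuples m r"
    by (simp add: image_subset_iff increasing_tuples_def finite_subset[of _ "{1..m}"])
qed

text \<open>Grouping the nonempty index sets by cardinality links the tuple form of
  inclusion-exclusion to the subset form.\<close>

lemma sum_increasing_tuples:
  fixes g :: "nat set \<Rightarrow> 'b::comm_ring_1"
  shows "(\<Sum>r=1..m. (-1) ^ (r - 1) * (\<Sum>ks\<in>increasing_tuples m r. g (set ks))) =
    (\<Sum>I | I \<subseteq> {1..m} \<and> I \<noteq> {}. (-1) ^ (card I + 1) * g I)"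
proof -
  let ?S = "{I. I \<subseteq> {1..m} \<and> I \<noteq> {}}"
  have fin: "finite ?S" by simp
  have range: "card ` ?S \<subseteq> {1..m}"
  proof (rule image_subsetI)
    fix I assume I: "I \<in> ?S"
    then have "finite I" "card I \<le> card {1..m}"
      using finite_subset[of I "{1..m}"] card_mono[of "{1..m}" I] by simp_all
    with I show "card I \<in> {1..m}"
      by (simp add: Suc_le_eq card_gt_0_iff)
  qed
  have "(\<Sum>I\<in>?S. (-1) ^ (card I + 1) * g I) =
      (\<Sum>r=1..m. \<Sum>I | I \<in> ?S \<and> card I = r. (-1) ^ (card I + 1) * g I)"
    using sum.group[OF fin _ range, of "\<lambda>I. (-1) ^ (card I + 1) * g I"] by simp
  also have "\<dots> = (\<Sum>r=1..m. (-1) ^ (r - 1) * (\<Sum>ks\<in>increasing_tuples m r. g (set ks)))"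
  proof (rule sum.cong[OF refl])
    fix r assume r: "r \<in> {1..m}"
    have eq: "{I. I \<in> ?S \<and> card I = r} = {I. I \<subseteq> {1..m} \<and> card I = r}"
      using r by auto
    \<comment> \<open>The exponents differ by 2 because \<open>r\<close> is at least 1, so
      \<open>r - 1\<close> does not truncate.\<close>
    have "(-1) ^ (r + 1) = ((-1) ^ (r - 1) :: 'b)"
      using r by (cases r) auto
    then have "(\<Sum>I | I \<in> ?S \<and> card I = r. (-1) ^ (card I + 1) * g I) =
        (-1) ^ (r - 1) * (\<Sum>I | I \<subseteq> {1..m} \<and> card I = r. g I)"
      unfolding eq sum_distrib_left by (intro sum.cong) auto
    also have "(\<Sum>I | I \<subseteq> {1..m} \<and> card I = r. g I) = (\<Sum>ks\<in>increasing_tuples m r. g (set ks))"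
      by (rule sum.reindex_bij_betw[OF bij_betw_set_increasing_tuples, symmetric])
    finally show "(\<Sum>I | I \<in> ?S \<and> card I = r. (-1) ^ (card I + 1) * g I) =
        (-1) ^ (r - 1) * (\<Sum>ks\<in>increasing_tuples m r. g (set ks))" .
  qed
  finally show ?thesis by simp
qed

theorem theorem1:
  fixes n m w :: nat and W :: "nat set" and G :: "nat set set" and V :: "nat \<Rightarrow> nat set"
  assumes "W = {1..n}"
    and "simple_game W G"
    and "m = card (minimal_winning G)"
    and "bij_betw V {1..m} (minimal_winning G)"
    and "w \<in> W"
  shows "int (banzhaf_score G w) =
    (\<Sum>r = 1..m. (-1) ^ (r - 1) * (\<Sum>ks \<in> increasing_tuples m r. tuple_term W V ks w))"
proof -
  define up where "up U = {C. U \<subseteq> C \<and> C \<subseteq> W}" for U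
  \<comment> \<open>The score itself is not additive over disjoint families, since whether
    \<open>C\<close> counts depends on \<open>C - {w}\<close>. The signed sum is additive and agrees
    with the score on families closed under adding \<open>w\<close>.\<close>
  define sgn_sum where "sgn_sum F = (\<Sum>C\<in>F. if w \<in> C then 1 else -1 :: int)" for F
  have finW: "finite W" and subW: "G \<subseteq> Pow W"
    using assms(2) by (auto simp: simple_game_def)
  have finG: "finite G"
    using finW subW by (auto intro: finite_subset)
  have fin_up: "finite (up U)" for U
    using finW by (auto simp: up_def intro: finite_subset[of _ "Pow W"])
  have V_image: "V ` {1..m} = minimal_winning G"
    using assms(4) by (rule bij_betw_imp_surj_on)
  have V_sub: "V i \<subseteq> W" if "i \<in> {1..m}" for i
    using that V_image subW unfolding minimal_winning_def by blast
  interpret Incl_Excl finite sgn_sum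
    by unfold_locales (auto simp: sgn_sum_def disjnt_def sum.union_disjoint)
  have sgn_up: "sgn_sum (up U) = (if w \<in> U then 2 ^ (card W - card U) else 0)" if "U \<subseteq> W" for U
  proof -
    have "insert w C \<in> up U" if "C \<in> up U" for C
      using that assms(5) by (auto simp: up_def)
    then have "sgn_sum (up U) = int (banzhaf_score (up U) w)"
      unfolding sgn_sum_def by (rule banzhaf_score_eq_sum_sign[OF fin_up, symmetric])
    then show ?thesis
      using that by (simp add: up_def banzhaf_score_subset_interval[OF finW])
  qed
  have "insert w C \<in> G" if "C \<in> G" for C
  proof -
    have "insert w C \<subseteq> W" using that subW assms(5) by blast
    then show ?thesis
      using that assms(2) unfolding simple_game_def by blast
  qed
  then have "int (banzhaf_score G w) = sgn_sum G"
    unfolding sgn_sum_def by (rule banzhaf_score_eq_sum_sign[OF finG])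
  \<comment> \<open>Passing to the enumeration \<open>V\<close> makes the union run over the indices
    that the tuples use.\<close>
  also have "\<dots> = sgn_sum (\<Union>i\<in>{1..m}. up (V i))"
    by (rule arg_cong[of _ _ sgn_sum])
      (use simple_game_eq_Union_intervals[OF assms(2)] in \<open>simp add: up_def flip: V_image\<close>)
  also have "\<dots> =
      (\<Sum>I | I \<subseteq> {1..m} \<and> I \<noteq> {}. (-1) ^ (card I + 1) * sgn_sum (\<Inter>i\<in>I. up (V i)))"
    by (rule restricted_indexed) (auto simp: fin_up)
  also have "\<dots> = (\<Sum>I | I \<subseteq> {1..m} \<and> I \<noteq> {}. (-1) ^ (card I + 1) *
      (if w \<in> (\<Union>i\<in>I. V i) then 2 ^ (card W - card (\<Union>i\<in>I. V i)) else 0))"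
  proof (rule sum.cong[OF refl])
    fix I assume I: "I \<in> {I. I \<subseteq> {1..m} \<and> I \<noteq> {}}"
    \<comment> \<open>This needs \<open>I\<close> nonempty: the empty intersection is the whole
      type, whereas \<open>up {}\<close> is \<open>Pow W\<close>.\<close>
    then have "(\<Inter>i\<in>I. up (V i)) = up (\<Union>i\<in>I. V i)"
      by (auto simp: up_def)
    moreover have "(\<Union>i\<in>I. V i) \<subseteq> W"
      using I V_sub by blast
    ultimately show "(-1) ^ (card I + 1) * sgn_sum (\<Inter>i\<in>I. up (V i)) = (-1) ^ (card I + 1) *
        (if w \<in> (\<Union>i\<in>I. V i) then 2 ^ (card W - card (\<Union>i\<in>I. V i)) else 0)"
      by (simp only: sgn_up)
  qed
  also have "\<dots> =
      (\<Sum>r=1..m. (-1) ^ (r - 1) * (\<Sum>ks\<in>increasing_tuples m r. tuple_term W V ks w))"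
    unfolding tuple_term_def by (rule sum_increasing_tuples[symmetric])
  finally show ?thesis .
qed

end
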